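(* For every integer $n\ge1$, we have $$d_{-\gamma_n}(1)=\varphi^{n-1}\big(2\,\overline{1}\big).$$ If $n \ge 1$ and $1<\beta\le\gamma_n$, then $d_{-\beta}(1)$ starts with the word $\varphi^n(2)$; hence $$\lim_{\beta\to1}d_{-\beta}(1)=\lim_{n\to\infty}\varphi^n\big(2\,\overline{1}\big)=211222112112112221122\cdots,$$ where $\beta\to1$ means $\beta$ tends to $1$ from above.
   Context: For real $\beta>1$, $T_{-\beta}:(0,1]\to(0,1]$, $x\mapsto -\beta x+\lfloor \beta x\rfloor+1$. For $x\in(0,1]$, $d_{-\beta}(x)=d_{-\beta,1}(x)\,d_{-\beta,2}(x)\cdots$ is the infinite word with $d_{-\beta,n}(x)=\lfloor\beta\,T_{-\beta}^{n-1}(x)\rfloor+1$ for $n\ge1$. $\varphi$ is the morphism of words over $\{1,2\}$ given by $\varphi(1)=2$, $\varphi(2)=211$, extended to finite words by concatenation and to infinite words in the natural way; $\varphi^0$ is the identity. $\overline{1}=111\cdots$ is the infinite constant word. Convergence of (infinite) words to an infinite word $u$ means that longer and longer prefixes agree with prefixes of $u$ (for every $\ell$, eventually the prefixes of length $\ell$ agree); the limit word here is the fixed point of $\varphi$ in $\{1,2\}^{\mathbb{N}}$. For $n\ge1$, $\gamma_n$ is the unique positive real number with $\gamma_n^{g_n+1}=\gamma_n+1$, where $g_n=\lfloor2^{n+1}/3\rfloor$. *)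

theory Defs
  imports Complex_Main "HOL-Library.Stream"
begin

text \<open>Infinite words are streams of integers and finite words are lists of integers.\<close>

definition T :: "real \<Rightarrow> real \<Rightarrow> real" where
  "T \<beta> x = - \<beta> * x + of_int \<lfloor>\<beta> * x\<rfloor> + 1"

text \<open>
  Streams are indexed from \<open>0\<close>: entry \<open>k\<close> of \<open>expansion \<beta> x\<close> is the letter usually written
  \<open>d\<close> with index \<open>-\<beta>, k + 1\<close>.
\<close>

definition expansion :: "real \<Rightarrow> real \<Rightarrow> int stream" where
  "expansion \<beta> x = smap (\<lambda>y. \<lfloor>\<beta> * y\<rfloor> + 1) (siterate (T \<beta>) x)"

text \<open>
  The morphism is only meaningful on the alphabet \<open>{1, 2}\<close>. Any other letter is left unchanged;
  this keeps all images nonempty, as \<^const>\<open>flat\<close> requires.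
\<close>

definition phi_letter :: "int \<Rightarrow> int list" where
  "phi_letter a = (if a = 1 then [2] else if a = 2 then [2, 1, 1] else [a])"

definition phi_fin :: "int list \<Rightarrow> int list" where
  "phi_fin w = concat (map phi_letter w)"

definition phi_inf :: "int stream \<Rightarrow> int stream" where
  "phi_inf s = flat (smap phi_letter s)"

definition starts_with :: "'a stream \<Rightarrow> 'a list \<Rightarrow> bool" where
  "starts_with s w \<longleftrightarrow> stake (length w) s = w"

definition word_tendsto :: "('b \<Rightarrow> 'a stream) \<Rightarrow> 'a stream \<Rightarrow> 'b filter \<Rightarrow> bool" where
  "word_tendsto f u F \<longleftrightarrow> (\<forall>l. \<forall>\<^sub>F x in F. stake l (f x) = stake l u)"

definition g :: "nat \<Rightarrow> nat" where
  "g n = nat \<lfloor>(2::real) ^ (n + 1) / 3\<rfloor>"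

definition gam :: "nat \<Rightarrow> real" where
  "gam n = (THE x. 0 < x \<and> x ^ (g n + 1) = x + 1)"

lemma g_pos:
  assumes "n \<ge> 1"
  shows "g n \<ge> 1"
proof -
  have "(2::real) ^ 2 \<le> 2 ^ (n + 1)"
    using assms by (intro power_increasing) auto
  then have "1 \<le> \<lfloor>(2::real) ^ (n + 1) / 3\<rfloor>"
    by (simp add: le_floor_iff)
  then show ?thesis
    unfolding g_def by linarith
qed

text \<open>The description in \<^const>\<open>gam\<close> is proper for \<open>n \<ge> 1\<close>.\<close>

lemma gam_ex1:
  assumes "n \<ge> 1"
  shows "\<exists>!x::real. 0 < x \<and> x ^ (g n + 1) = x + 1"
proof -
  define m where "m = g n"
  have m: "m \<ge> 1"
    using g_pos[OF assms] by (simp add: m_def)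
  have gt1: "x > 1" if "0 < x" "x ^ (m + 1) = x + 1" for x :: real
    using that power_le_one[of x "m + 1"] by fastforce
  have less: "x * (x ^ m - 1) < y * (y ^ m - 1)" if "1 < x" "x < y" for x y :: real
  proof (rule mult_strict_mono)
    show "x ^ m - 1 < y ^ m - 1"
      using that m by (simp add: power_strict_mono)
    show "0 \<le> x ^ m - 1"
      using that one_le_power[of x m] by simp
  qed (use that in auto)
  have "\<exists>x\<ge>1. x \<le> 2 \<and> x ^ (m + 1) - x = (1::real)"
  proof (rule IVT')
    have "(2::real) ^ 2 \<le> 2 ^ (m + 1)"
      using m by (intro power_increasing) auto
    then show "1 \<le> (2::real) ^ (m + 1) - 2"
      by simp
  qed (auto intro!: continuous_intros)
  then obtain x :: real where x: "0 < x" "x ^ (m + 1) = x + 1"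
    by (force simp: algebra_simps)
  have "y = x" if y: "0 < y" "y ^ (m + 1) = y + 1" for y
    using less[of x y] less[of y x] gt1[OF x] gt1[OF y] x(2) y(2)
    by (cases x y rule: linorder_cases) (auto simp: algebra_simps)
  with x show ?thesis
    unfolding m_def by blast
qed

end

theory Submission
  imports Defs
begin

text \<open>
  The point \<open>1\<close> is followed through the renormalisations of \<open>T\<^sub>-\<^sub>\<beta>\<close>. On \<open>(lo, 1]\<close> consider a map
  with two decreasing affine branches, both with supremum \<open>1\<close> at their left ends: branch \<open>1\<close> has
  slope \<open>-a\<close> on \<open>(lo, c)\<close> and reaches \<open>lo\<close> at \<open>c\<close>; branch \<open>2\<close> has slope \<open>-b\<close> on \<open>(c, 1]\<close>.
  Replacing the letters \<open>1\<close>, \<open>2\<close> by the words \<open>2\<close>, \<open>211\<close> gives a map of the same shape on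
  \<open>(c, 1]\<close>, with slopes \<open>-b\<close> and \<open>-a\<^sup>2b\<close>, and the only thing required is \<open>a (a - 1) (b - 1) < 1\<close>.
  Starting from \<open>a = b = \<beta>\<close>, the slopes are powers of \<open>\<beta>\<close> with Jacobsthal numbers as exponents,
  and \<open>\<beta> \<le> \<gamma>\<^sub>n\<close> makes the first \<open>n\<close> renormalisations possible. At \<open>\<beta> = \<gamma>\<^sub>n\<close> the level \<open>n - 1\<close>
  branch \<open>2\<close> sends \<open>1\<close> to the fixed point of branch \<open>1\<close>.
\<close>

section \<open>The morphism and its fixed point\<close>

lemma phi_fin_simps [simp]:
  "phi_fin [] = []" "phi_fin (x # w) = phi_letter x @ phi_fin w"
  "phi_fin (v @ w) = phi_fin v @ phi_fin w"
  by (simp_all add: phi_fin_def)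

lemma phi_letter_simps [simp]: "phi_letter 1 = [2]" "phi_letter 2 = [2, 1, 1]"
  by (simp_all add: phi_letter_def)

lemma phi_letter_ne [simp]: "phi_letter a \<noteq> []"
  by (simp add: phi_letter_def)

lemma phi_inf_SCons: "phi_inf (a ## s) = phi_letter a @- phi_inf s"
  by (simp add: phi_inf_def)

lemma phi_inf_shift: "phi_inf (w @- s) = phi_fin w @- phi_inf s"
  by (induction w) (simp_all add: phi_inf_SCons)

lemma phi_inf_funpow_shift: "(phi_inf ^^ n) (w @- s) = (phi_fin ^^ n) w @- (phi_inf ^^ n) s"
  by (induction n) (simp_all add: phi_inf_shift)

lemma phi_fin_funpow_append: "(phi_fin ^^ n) (v @ w) = (phi_fin ^^ n) v @ (phi_fin ^^ n) w"
  by (induction n) simp_all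

text \<open>Since \<open>2\<close> is a prefix of its image \<open>211\<close>, the iterates on
  \<open>[2]\<close> are nested prefixes; this underlies the existence of the limit word.\<close>

lemma phi_fin_funpow_two_Suc:
  "(phi_fin ^^ Suc n) [2] = (phi_fin ^^ n) [2] @ (phi_fin ^^ n) [1, 1]"
proof -
  have "(phi_fin ^^ Suc n) [2] = (phi_fin ^^ n) ([2] @ [1, 1])"
    unfolding funpow_Suc_right by simp
  then show ?thesis
    by (simp only: phi_fin_funpow_append)
qed

lemma length_phi_fin_ge: "length w \<le> length (phi_fin w)"
proof (induction w)
  case (Cons x w)
  have "1 \<le> length (phi_letter x)"
    by (simp add: phi_letter_def)
  with Cons show ?case
    by simp
qed simp

lemma length_phi_fin_funpow_ge: "length w \<le> length ((phi_fin ^^ n) w)"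
  by (induction n) (auto intro: order_trans length_phi_fin_ge)

lemma length_phi_fin_funpow_two: "n < length ((phi_fin ^^ n) [2])"
proof (induction n)
  case (Suc n)
  moreover have "0 < length ((phi_fin ^^ n) [1, 1])"
    using length_phi_fin_funpow_ge[of "[1, 1]" n] by (simp del: length_greater_0_conv)
  ultimately show ?case
    unfolding phi_fin_funpow_two_Suc length_append by linarith
qed simp

lemma set_phi_fin_funpow: "set w \<subseteq> {1, 2} \<Longrightarrow> set ((phi_fin ^^ n) w) \<subseteq> {1, 2}"
  by (induction n) (auto simp: phi_fin_def phi_letter_def split: if_splits)

section \<open>Prefixes of streams and the limit word\<close>

lemma starts_with_iff: "starts_with s w \<longleftrightarrow> (\<exists>t. s = w @- t)"
proof
  assume "starts_with s w"
  then show "\<exists>t. s = w @- t"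
    unfolding starts_with_def by (metis stake_sdrop)
qed (auto simp: starts_with_def stake_shift)

lemma starts_with_phi_inf: "starts_with s w \<Longrightarrow> starts_with (phi_inf s) (phi_fin w)"
  by (auto simp: starts_with_iff phi_inf_shift)

lemma starts_with_agree:
  assumes "starts_with s w" "starts_with t w" "l \<le> length w"
  shows "stake l s = stake l t"
  using assms by (auto simp: starts_with_iff stake_shift)

lemma stream_eqI_starts_with:
  assumes "\<And>n. starts_with s (w n)" "\<And>n. starts_with t (w n)" "\<And>n. n \<le> length (w n)"
  shows "s = t"
proof -
  have "s !! i = t !! i" for i
  proof -
    have "stake (Suc i) s = stake (Suc i) t"
      using assms by (intro starts_with_agree[of _ "w (Suc i)"]) auto
    then show ?thesis
      by (metis lessI stake_nth)
  qed
  then have "snth s = snth t"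
    by blast
  then show ?thesis
    by (metis stream_smap_nats)
qed

text \<open>A diagonal reading: the \<open>k\<close>-th iterate has more than \<open>k\<close>
  letters, so the index is valid, and by nestedness every longer iterate has the same letter
  there.\<close>

definition phi_limit :: "int stream" where
  "phi_limit = smap (\<lambda>k. (phi_fin ^^ k) [2] ! k) nats"

lemma phi_fin_funpow_two_add: "\<exists>v. (phi_fin ^^ (n + m)) [2] = (phi_fin ^^ n) [2] @ v"
proof (induction m)
  case (Suc m)
  then show ?case
    using phi_fin_funpow_two_Suc[of "n + m"] by fastforce
qed simp

lemma nth_phi_fin_funpow_two:
  assumes "k < length ((phi_fin ^^ n) [2])"
  shows "(phi_fin ^^ k) [2] ! k = (phi_fin ^^ n) [2] ! k"
proof (cases "k \<le> n")
  case True
  then show ?thesis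
    using phi_fin_funpow_two_add[of k "n - k"] length_phi_fin_funpow_two[of k]
    by (auto simp: nth_append)
next
  case False
  then show ?thesis
    using phi_fin_funpow_two_add[of n "k - n"] assms
    by (auto simp: nth_append)
qed

lemma starts_with_phi_limit: "starts_with phi_limit ((phi_fin ^^ n) [2])"
  unfolding starts_with_def
  by (rule nth_equalityI) (simp_all add: phi_limit_def nth_phi_fin_funpow_two)

lemma stream_eq_phi_limit:
  assumes "\<And>n. starts_with s ((phi_fin ^^ n) [2])"
  shows "s = phi_limit"
  by (rule stream_eqI_starts_with[where w = "\<lambda>n. (phi_fin ^^ n) [2]"])
    (simp_all add: assms starts_with_phi_limit less_imp_le length_phi_fin_funpow_two)

lemma phi_limit_in_streams: "phi_limit \<in> streams {1, 2}"
proof -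
  have "(phi_fin ^^ k) [2] ! k \<in> {1, 2}" for k
    using set_phi_fin_funpow[of "[2]" k] nth_mem[OF length_phi_fin_funpow_two[of k]] by auto
  then show ?thesis
    by (simp add: phi_limit_def streams_iff_snth)
qed

lemma phi_inf_phi_limit: "phi_inf phi_limit = phi_limit"
proof (rule stream_eq_phi_limit)
  fix n
  show "starts_with (phi_inf phi_limit) ((phi_fin ^^ n) [2])"
  proof (cases n)
    case 0
    have "starts_with (phi_inf phi_limit) (phi_fin [2])"
      using starts_with_phi_inf[OF starts_with_phi_limit[of 0]] by simp
    then show ?thesis
      using 0 by (auto simp: starts_with_iff)
  next
    case (Suc m)
    then show ?thesis
      using starts_with_phi_inf[OF starts_with_phi_limit[of m]] by simp
  qed
qed

text \<open>Both letter images begin with \<open>2\<close>, so a fixed point does too; applying the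
  morphism repeatedly to this prefix forces all iterates on \<open>[2]\<close> as prefixes.\<close>

lemma phi_inf_fixed_point_unique:
  assumes "v \<in> streams {1, 2}" "phi_inf v = v"
  shows "v = phi_limit"
proof (rule stream_eq_phi_limit)
  fix n
  show "starts_with v ((phi_fin ^^ n) [2])"
  proof (induction n)
    case 0
    obtain x t where v: "v = x ## t"
      by (cases v)
    with assms(1) have "x = 1 \<or> x = 2"
      by (auto simp: streams_Stream)
    then show ?case
      using assms(2) v by (auto simp: phi_inf_SCons starts_with_iff)
  next
    case (Suc n)
    then show ?case
      using starts_with_phi_inf[OF Suc.IH] assms(2) by simp
  qed
qed

section \<open>Renormalisation\<close>

text \<open>Says that \<open>w\<close> is an itinerary of \<open>y\<close> under the two-branch map.
  The breakpoint \<open>c\<close> is excluded, which fits the half-open domain \<open>(c, 1]\<close>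
  of the next level.\<close>

fun adm :: "real \<Rightarrow> real \<Rightarrow> real \<Rightarrow> real \<Rightarrow> int list \<Rightarrow> real \<Rightarrow> bool" where
  "adm lo c a b [] y \<longleftrightarrow> True"
| "adm lo c a b (l # w) y \<longleftrightarrow>
     (l = 1 \<and> lo < y \<and> y < c \<and> adm lo c a b w (1 - a * (y - lo))) \<or>
     (l = 2 \<and> c < y \<and> y \<le> 1 \<and> adm lo c a b w (1 - b * (y - c)))"

text \<open>With \<open>lo = 0\<close>, \<open>c = 1 / \<beta>\<close> and both slopes \<beta>, the
  branches are those of \<open>T\<close>; \<beta> < 2 leaves only 0 and 1 as values of the
  floor.\<close>

lemma adm_starts_with_expansion:
  assumes "1 < \<beta>" "\<beta> < 2" "adm 0 (1 / \<beta>) \<beta> \<beta> w y"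
  shows "starts_with (expansion \<beta> y) w"
  using assms(3)
proof (induction w arbitrary: y)
  case Nil
  then show ?case
    by (simp add: starts_with_def)
next
  case (Cons l w)
  have step: "expansion \<beta> y = (\<lfloor>\<beta> * y\<rfloor> + 1) ## expansion \<beta> (T \<beta> y)"
    by (simp add: expansion_def siterate.code[of _ y])
  consider (1) "l = 1" "0 < y" "y < 1 / \<beta>" "adm 0 (1 / \<beta>) \<beta> \<beta> w (1 - \<beta> * y)"
    | (2) "l = 2" "1 / \<beta> < y" "y \<le> 1" "adm 0 (1 / \<beta>) \<beta> \<beta> w (1 - \<beta> * (y - 1 / \<beta>))"
    using Cons.prems by auto
  then show ?case
  proof cases
    case 1
    have "0 \<le> \<beta> * y" "\<beta> * y < 1"
      using 1 assms(1) by (simp_all add: field_simps)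
    then have "\<lfloor>\<beta> * y\<rfloor> = 0"
      by linarith
    then show ?thesis
      using Cons.IH[OF 1(4)] 1(1) step by (simp add: T_def starts_with_def)
  next
    case 2
    have "\<beta> * y \<le> \<beta>" "1 < \<beta> * y"
      using 2 assms(1) by (simp_all add: field_simps)
    then have "\<lfloor>\<beta> * y\<rfloor> = 1"
      using assms(2) by linarith
    moreover have B: "1 - \<beta> * (y - 1 / \<beta>) = 2 - \<beta> * y"
      using assms(1) by (simp add: field_simps)
    ultimately show ?thesis
      using Cons.IH[OF 2(4), unfolded B] 2(1) step by (simp add: T_def starts_with_def)
  qed
qed

text \<open>One renormalisation, read backwards. Branch 2 sends \<open>c'\<close> to
  \<open>c\<close>, so points of \<open>(c, c')\<close> stay above \<open>c\<close> after one step
  (word \<open>2\<close>), while points of \<open>(c', 1]\<close> fall below \<open>c\<close> and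
  need two steps of branch 1 (word \<open>211\<close>) before the new branch 2 is completed.\<close>

lemma adm_phi_fin:
  fixes lo c a b :: real
  assumes a: "1 < a" and b: "1 < b" and lo: "lo < 1"
    and c: "a * (c - lo) = 1 - lo"
    and crit: "a * (a - 1) * (b - 1) < 1"
    and c': "b * (c' - c) = 1 - c"
    and adm: "adm c c' b (a\<^sup>2 * b) w y"
  shows "adm lo c a b (phi_fin w) y"
  using adm
proof (induction w arbitrary: y)
  case (Cons l w)
  have "c - lo = (1 - lo) / a"
    using c a by (simp add: field_simps)
  moreover have "(1 - lo) / a < 1 - lo" "0 < (1 - lo) / a"
    using a lo by (simp_all add: divide_less_eq)
  ultimately have c_lo: "lo < c" and c_1: "c < 1"
    by linarith+
  have "c' - c = (1 - c) / b"
    using c' b by (simp add: field_simps)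
  moreover have "(1 - c) / b < 1 - c" "0 < (1 - c) / b"
    using b c_1 by (simp_all add: divide_less_eq)
  ultimately have c'_c: "c < c'" and c'_1: "c' < 1"
    by linarith+
  have B: "1 - b * (y - c) = c - b * (y - c')"
    using c' by (simp add: algebra_simps)
  have A: "1 - a * (c - t - lo) = lo + a * t" for t
    using c by (simp add: algebra_simps)
  consider (1) "l = 1" "c < y" "y < c'" "adm c c' b (a\<^sup>2 * b) w (1 - b * (y - c))"
    | (2) "l = 2" "c' < y" "y \<le> 1" "adm c c' b (a\<^sup>2 * b) w (1 - a\<^sup>2 * b * (y - c'))"
    using Cons.prems by auto
  then show ?case
  proof cases
    case 1
    then show ?thesis
      using Cons.IH[OF 1(4)] c'_1 by simp
  next
    case 2
    \<comment> \<open>The first image of \<open>y\<close> is \<open>c - t\<close>, the second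
      \<open>lo + a * t\<close>. Both must lie in \<open>(lo, c)\<close>; the worst case is
      \<open>y = 1\<close>, where the bound \<open>a * t < c - lo\<close> amounts exactly to
      \<open>crit\<close>.\<close>
    define t where "t = b * (y - c')"
    have "a * (b * (1 - c')) < c - lo"
    proof -
      have "b * (1 - c') = (b - 1) * (1 - c)"
        using c' by (simp add: algebra_simps)
      then have "a * (a * (b * (1 - c'))) = a * (a * (b - 1) * (1 - c))"
        by (simp add: mult.assoc)
      also have "\<dots> = a * (b - 1) * (a * (1 - lo) - a * (c - lo))"
        by (simp add: algebra_simps)
      also have "\<dots> = a * (a - 1) * (b - 1) * (1 - lo)"
        unfolding c by (simp add: algebra_simps)
      also have "\<dots> < 1 * (1 - lo)"
        using crit lo by (intro mult_strict_right_mono) auto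
      also have "\<dots> = a * (c - lo)"
        using c by simp
      finally show ?thesis
        using a by simp
    qed
    moreover have "a * t \<le> a * (b * (1 - c'))"
      using a b 2 by (simp add: t_def)
    ultimately have at: "a * t < c - lo"
      by linarith
    have t: "0 < t"
      using b 2 by (simp add: t_def)
    then have "t < a * t"
      using a by simp
    with at have "lo < c - t"
      by linarith
    moreover have "1 - a * (a * t) = 1 - a\<^sup>2 * b * (y - c')"
      by (simp add: t_def power2_eq_square)
    ultimately show ?thesis
      using Cons.IH[OF 2(4)] at t a 2 c'_c B A[of t] by (simp add: t_def[symmetric])
  qed
qed simp

text \<open>Jacobsthal numbers 1, 1, 3, 5, 11, ...: the slope change from \<open>(a, b)\<close> to
  \<open>(b, a\<^sup>2 * b)\<close> acts on exponents of \<beta> by this recursion.\<close>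

fun jac :: "nat \<Rightarrow> nat" where
  "jac 0 = 1"
| "jac (Suc 0) = 1"
| "jac (Suc (Suc n)) = jac (Suc n) + 2 * jac n"

lemma jac_pos: "0 < jac n"
  by (induction n rule: jac.induct) auto

lemma jac_le_Suc: "jac n \<le> jac (Suc n)"
  by (induction n rule: jac.induct) auto

lemma jac_mono: "m \<le> n \<Longrightarrow> jac m \<le> jac n"
  by (rule lift_Suc_mono_le[of jac]) (auto intro: jac_le_Suc)

lemma jac_Suc: "(even n \<longrightarrow> jac (Suc n) + 1 = 2 * jac n) \<and> (odd n \<longrightarrow> jac (Suc n) = 2 * jac n + 1)"
  by (induction n) auto

lemma jac_closed_form:
  "(even n \<longrightarrow> 3 * jac n = 2 ^ (n + 1) + 1) \<and> (odd n \<longrightarrow> 3 * jac n + 1 = 2 ^ (n + 1))"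
proof (induction n)
  case (Suc n)
  then show ?case
    using jac_Suc[of n] by (cases "even n") auto
qed simp

text \<open>The power \<open>2 ^ (n + 1)\<close> is \<open>3 * jac n - 1\<close> for even
  \<open>n\<close> and \<open>3 * jac n + 1\<close> for odd \<open>n\<close>, which fixes the floor
  of its third.\<close>

lemma g_eq_jac: "g n = (if even n then jac n - 1 else jac n)"
proof -
  have "\<lfloor>(2::real) ^ (n + 1) / 3\<rfloor> = int (2 ^ (n + 1) div 3)"
    using floor_divide_of_nat_eq[of "2 ^ (n + 1)" 3, where ?'a = real] by simp
  then have "g n = 2 ^ (n + 1) div 3"
    unfolding g_def by simp
  also have "\<dots> = (if even n then jac n - 1 else jac n)"
    using jac_closed_form[of n] jac_pos[of n] by (cases "even n") (simp, presburger)+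
  finally show ?thesis .
qed

lemma adm_phi_fin_funpow:
  fixes \<beta> :: real
  assumes \<beta>: "1 < \<beta>"
    and crit: "\<And>k. k < n \<Longrightarrow> \<beta> ^ jac k * (\<beta> ^ jac k - 1) * (\<beta> ^ jac (Suc k) - 1) < 1"
  shows "\<exists>lo c. lo < c \<and> c < 1 \<and> \<beta> ^ jac n * (c - lo) = 1 - lo \<and>
    (\<forall>w y. adm lo c (\<beta> ^ jac n) (\<beta> ^ jac (Suc n)) w y \<longrightarrow>
      adm 0 (1 / \<beta>) \<beta> \<beta> ((phi_fin ^^ n) w) y)"
  using crit
proof (induction n)
  case 0
  show ?case
    by (rule exI[of _ 0], rule exI[of _ "1 / \<beta>"]) (use \<beta> in simp)
next
  case (Suc n)
  define a b where "a = \<beta> ^ jac n" and "b = \<beta> ^ jac (Suc n)"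
  have ab: "1 < a" "1 < b"
    using \<beta> jac_pos by (simp_all add: a_def b_def)
  have b': "\<beta> ^ jac (Suc (Suc n)) = a\<^sup>2 * b"
    by (simp add: a_def b_def power_add power_mult[symmetric] mult.commute)
  obtain lo c where lo: "lo < c" "c < 1" and c: "a * (c - lo) = 1 - lo"
    and adm: "\<And>w y. adm lo c a b w y \<Longrightarrow> adm 0 (1 / \<beta>) \<beta> \<beta> ((phi_fin ^^ n) w) y"
    using Suc.IH Suc.prems unfolding a_def b_def by force
  \<comment> \<open>The preimage of \<open>c\<close> under branch 2, which is the breakpoint of the
    next level.\<close>
  define c' where "c' = c + (1 - c) / b"
  have c': "b * (c' - c) = 1 - c"
    using ab by (simp add: c'_def)
  have "0 < (1 - c) / b" "(1 - c) / b < 1 - c"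
    using ab lo by (simp_all add: divide_less_eq)
  then have bounds: "c < c'" "c' < 1"
    by (simp_all add: c'_def)
  have "adm 0 (1 / \<beta>) \<beta> \<beta> ((phi_fin ^^ Suc n) w) y" if "adm c c' b (a\<^sup>2 * b) w y" for w y
  proof -
    have "adm lo c a b (phi_fin w) y"
      using adm_phi_fin[OF ab _ c _ c' that] lo Suc.prems[of n] by (simp add: a_def b_def)
    \<comment> \<open>The new application of the morphism is the innermost one: level
      \<open>n\<close> already handles the outer \<open>n\<close> of them.\<close>
    then show ?thesis
      using adm by (simp only: funpow_Suc_right o_apply)
  qed
  then show ?case
    using bounds c' unfolding b' b_def[symmetric] by blast
qed

section \<open>The numbers \<open>\<gamma>\<^sub>n\<close>\<close>

lemma gam_properties:
  assumes "n \<ge> 1"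
  shows "1 < gam n" "gam n ^ (g n + 1) = gam n + 1"
proof -
  have *: "0 < gam n \<and> gam n ^ (g n + 1) = gam n + 1"
    unfolding gam_def by (rule theI'[OF gam_ex1[OF assms]])
  then show "gam n ^ (g n + 1) = gam n + 1"
    by simp
  show "1 < gam n"
    using * power_le_one[of "gam n" "g n + 1"] by fastforce
qed

text \<open>The inequality says \<open>x * (x ^ g n - 1) \<le> 1\<close>, whose left side is
  monotone for \<open>x \<ge> 1\<close> and equals 1 at \<open>gam n\<close>.\<close>

lemma power_le_of_le_gam:
  assumes "n \<ge> 1" "1 < \<beta>" "\<beta> \<le> gam n"
  shows "\<beta> ^ (g n + 1) \<le> \<beta> + 1"
proof -
  have "\<beta> * (\<beta> ^ g n - 1) \<le> gam n * (gam n ^ g n - 1)"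
    using assms one_le_power[of \<beta> "g n"]
    by (intro mult_mono diff_right_mono power_mono) auto
  also have "\<dots> = 1"
    using gam_properties(2)[OF assms(1)] by (simp add: algebra_simps)
  finally show ?thesis
    by (simp add: algebra_simps)
qed

lemma less_two_of_power_le:
  fixes \<beta> :: real
  assumes "n \<ge> 1" "1 < \<beta>" "\<beta> ^ (g n + 1) \<le> \<beta> + 1"
  shows "\<beta> < 2"
proof (rule ccontr)
  assume "\<not> \<beta> < 2"
  then have "2 * \<beta> \<le> \<beta> ^ 2"
    by (simp add: power2_eq_square)
  also have "\<dots> \<le> \<beta> ^ (g n + 1)"
    using g_pos[OF assms(1)] assms(2) by (intro power_increasing) auto
  also have "\<dots> \<le> \<beta> + 1"
    by (rule assms(3))
  finally have "2 * \<beta> \<le> \<beta> + 1" .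
  with assms(2) show False
    by simp
qed

text \<open>Expresses the power in the equation of \<open>gam (Suc m)\<close>, and the slope of
  branch 2 at level \<open>m\<close>, through the slope of branch 1. The parity split comes from the
  alternating correction in \<open>jac_Suc\<close>.\<close>

lemma renormalisation_exponents:
  fixes \<beta> :: real
  defines "a \<equiv> \<lambda>m. \<beta> ^ jac m"
  shows "even m \<Longrightarrow> \<beta> ^ (g (Suc m) + 1) = (a m)\<^sup>2"
    and "even m \<Longrightarrow> a (Suc m) * \<beta> = (a m)\<^sup>2"
    and "odd m \<Longrightarrow> \<beta> ^ (g (Suc m) + 1) = (a m)\<^sup>2 * \<beta>"
    and "odd m \<Longrightarrow> a (Suc m) = (a m)\<^sup>2 * \<beta>"
proof -
  assume "even m"
  then have e: "jac (Suc m) + 1 = jac m * 2" "g (Suc m) + 1 = jac m * 2"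
    using jac_Suc[of m] by (auto simp: g_eq_jac)
  show "\<beta> ^ (g (Suc m) + 1) = (a m)\<^sup>2"
    unfolding e a_def power_mult ..
  have "\<beta> ^ (jac (Suc m) + 1) = (a m)\<^sup>2"
    unfolding e a_def power_mult ..
  then show "a (Suc m) * \<beta> = (a m)\<^sup>2"
    by (simp add: a_def mult.commute)
next
  assume "odd m"
  then have e: "jac (Suc m) = jac m * 2 + 1" "g (Suc m) + 1 = jac m * 2 + 1"
    using jac_Suc[of m] by (auto simp: g_eq_jac)
  show "\<beta> ^ (g (Suc m) + 1) = (a m)\<^sup>2 * \<beta>"
    unfolding e a_def power_add power_mult by simp
  show "a (Suc m) = (a m)\<^sup>2 * \<beta>"
    unfolding e a_def power_add power_mult by simp
qed

lemma renormalisable: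
  fixes \<beta> :: real
  assumes \<beta>: "1 < \<beta>" and le: "\<beta> ^ (g (Suc m) + 1) \<le> \<beta> + 1" and "k \<le> m"
  shows "\<beta> ^ jac k * (\<beta> ^ jac k - 1) * (\<beta> ^ jac (Suc k) - 1) < 1"
proof -
  define a b where "a = \<beta> ^ jac m" and "b = \<beta> ^ jac (Suc m)"
  have a: "\<beta> \<le> a"
    using \<beta> power_increasing[of 1 "jac m" \<beta>] jac_pos[of m] by (simp add: a_def)
  have b: "1 \<le> b"
    using \<beta> by (simp add: b_def)
  \<comment> \<open>The critical quantity grows with the level, so only level \<open>m\<close> has
    to be checked.\<close>
  have mono: "\<beta> ^ jac k \<le> a" "\<beta> ^ jac (Suc k) \<le> b"
    using \<beta> jac_mono[of k m] jac_mono[of "Suc k" "Suc m"] \<open>k \<le> m\<close>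
    by (auto simp: a_def b_def intro!: power_increasing simp del: jac.simps)
  have "1 \<le> \<beta> ^ jac k" "1 \<le> \<beta> ^ jac (Suc k)"
    using \<beta> by (simp_all add: one_le_power)
  then have "\<beta> ^ jac k * (\<beta> ^ jac k - 1) * (\<beta> ^ jac (Suc k) - 1) \<le> a * (a - 1) * (b - 1)"
    using mono by (intro mult_mono diff_right_mono) auto
  also have "\<dots> < 1"
  proof (cases "even m")
    case True
    have a2: "a\<^sup>2 \<le> \<beta> + 1" and ba: "b * \<beta> = a\<^sup>2"
      using le renormalisation_exponents(1,2)[OF True, of \<beta>] by (simp_all add: a_def b_def)
    \<comment> \<open>After multiplication by \<beta> both factors are at most 1: they are
      \<open>a\<^sup>2 - a\<close> and \<open>a\<^sup>2 - \<beta>\<close>, with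
      \<open>a\<^sup>2 \<le> \<beta> + 1\<close> and \<open>\<beta> \<le> a\<close>.\<close>
    have "\<beta> * (a * (a - 1) * (b - 1)) = (a\<^sup>2 - a) * (b * \<beta> - \<beta>)"
      by (simp add: algebra_simps power2_eq_square)
    also have "\<dots> \<le> 1 * 1"
    proof (rule mult_mono)
      show "0 \<le> b * \<beta> - \<beta>"
        using b \<beta> by simp
    qed (use a2 ba a in auto)
    also have "\<dots> < \<beta> * 1"
      using \<beta> by simp
    finally show ?thesis
      using \<beta> by (simp only: mult_less_cancel_left_pos)
  next
    case False
    have b_eq: "b = a\<^sup>2 * \<beta>"
      using renormalisation_exponents(4)[OF False, of \<beta>] by (simp add: a_def b_def)
    have "b \<le> \<beta> + 1"
      using le unfolding renormalisation_exponents(3,4)[OF False, of \<beta>] b_def .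
    then have "a * (a - 1) * (b - 1) \<le> a * (a - 1) * \<beta>"
      using a \<beta> by (intro mult_left_mono) auto
    also have "\<dots> = b - a * \<beta>"
      by (simp add: b_eq algebra_simps power2_eq_square)
    also have "\<dots> < 1"
    proof -
      have "1 * \<beta> < a * \<beta>"
        using a \<beta> by (intro mult_strict_right_mono) auto
      with \<open>b \<le> \<beta> + 1\<close> show ?thesis
        by simp
    qed
    finally show ?thesis .
  qed
  finally show ?thesis .
qed

section \<open>Expansions of 1\<close>

lemma expansion_starts_with_phi:
  assumes "n \<ge> 1" "1 < \<beta>" "\<beta> \<le> gam n"
  shows "starts_with (expansion \<beta> 1) ((phi_fin ^^ n) [2])"
proof -
  obtain m where n: "n = Suc m"
    using assms(1) by (cases n) auto
  note le = power_le_of_le_gam[OF assms]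
  obtain lo c where "lo < c" "c < 1" and adm:
    "\<And>w y. adm lo c (\<beta> ^ jac n) (\<beta> ^ jac (Suc n)) w y \<Longrightarrow>
      adm 0 (1 / \<beta>) \<beta> \<beta> ((phi_fin ^^ n) w) y"
    using adm_phi_fin_funpow[OF assms(2), of n] renormalisable[OF assms(2), of m] le n
    by (metis less_Suc_eq_le)
  \<comment> \<open>At level \<open>n\<close> the point 1 lies in branch 2 because
    \<open>c < 1\<close>, so the one-letter word \<open>[2]\<close> is admissible there.\<close>
  then have "adm 0 (1 / \<beta>) \<beta> \<beta> ((phi_fin ^^ n) [2]) 1"
    by (intro adm) simp
  then show ?thesis
    using adm_starts_with_expansion[OF assms(2) less_two_of_power_le[OF assms(1,2) le]] by blast
qed

text \<open>This relation between the level \<open>m\<close> slopes is what makes branch 2 send 1 to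
  the fixed point of branch 1.\<close>

lemma gam_slopes:
  fixes m :: nat
  defines "a \<equiv> gam (Suc m) ^ jac m" and "b \<equiv> gam (Suc m) ^ jac (Suc m)"
  shows "b * (a\<^sup>2 - 1) = a\<^sup>2"
proof -
  define \<beta> where "\<beta> = gam (Suc m)"
  have \<beta>: "1 < \<beta>" "\<beta> ^ (g (Suc m) + 1) = \<beta> + 1"
    using gam_properties[of "Suc m"] by (simp_all add: \<beta>_def)
  show ?thesis
  proof (cases "even m")
    case True
    have "a\<^sup>2 = \<beta> + 1" "b * \<beta> = a\<^sup>2"
      using \<beta>(2) renormalisation_exponents(1,2)[OF True, of \<beta>]
      by (simp_all add: a_def b_def \<beta>_def)
    then show ?thesis
      by simp
  next
    case False
    have b: "b = a\<^sup>2 * \<beta>" "a\<^sup>2 * \<beta> = \<beta> + 1"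
      using \<beta>(2) renormalisation_exponents(3,4)[OF False, of \<beta>]
      by (simp_all add: a_def b_def \<beta>_def)
    have "b * (a\<^sup>2 - 1) = a\<^sup>2 * (a\<^sup>2 * \<beta> - \<beta>)"
      by (simp add: b(1) algebra_simps)
    then show ?thesis
      using b(2) by simp
  qed
qed

lemma adm_replicate_fixed_point:
  assumes "lo < y" "y < c" "1 - a * (y - lo) = y"
  shows "adm lo c a b (replicate k 1) y"
  using assms by (induction k) auto

lemma expansion_gam:
  "expansion (gam (Suc m)) 1 = (phi_inf ^^ m) (2 ## sconst 1)"
proof -
  define \<beta> where "\<beta> = gam (Suc m)"
  define a b where "a = \<beta> ^ jac m" and "b = \<beta> ^ jac (Suc m)"
  have \<beta>: "1 < \<beta>"
    using gam_properties[of "Suc m"] by (simp add: \<beta>_def)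
  have le: "\<beta> ^ (g (Suc m) + 1) \<le> \<beta> + 1"
    using gam_properties[of "Suc m"] by (simp add: \<beta>_def)
  have a: "1 < a"
    using \<beta> jac_pos[of m] by (simp add: a_def)
  obtain lo c where lo: "lo < c" "c < 1" "a * (c - lo) = 1 - lo" and adm:
    "\<And>w y. adm lo c a b w y \<Longrightarrow> adm 0 (1 / \<beta>) \<beta> \<beta> ((phi_fin ^^ m) w) y"
    using adm_phi_fin_funpow[OF \<beta>, of m] renormalisable[OF \<beta> le] unfolding a_def b_def
    by (metis less_imp_le)
  \<comment> \<open>The solution of \<open>1 - a * (z - lo) = z\<close>, the fixed point of branch
    1. Once the orbit of 1 reaches it, all further letters at level \<open>m\<close> are
    \<open>1\<close>.\<close>
  define z where "z = lo + (1 - lo) / (a + 1)"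
  have z: "1 - b * (1 - c) = z"
  proof -
    have "a * (1 - c) = (a - 1) * (1 - lo)"
      using lo(3) by (simp add: algebra_simps)
    then have c: "1 - c = (a - 1) * (1 - lo) / a"
      using a by (simp add: field_simps)
    have b: "b * (a - 1) = a\<^sup>2 / (a + 1)"
      using gam_slopes[of m] a
      by (simp add: a_def[symmetric] b_def[symmetric] \<beta>_def[symmetric] field_simps power2_eq_square)
    have "b * (1 - c) = b * (a - 1) * (1 - lo) / a"
      by (simp add: c)
    also have "\<dots> = a * (1 - lo) / (a + 1)"
      unfolding b using a by (simp add: power2_eq_square)
    finally show ?thesis
      using a by (simp add: z_def field_simps)
  qed
  have "lo < z"
    using lo a by (simp add: z_def)
  moreover have "z < c"
  proof -
    have "(1 - lo) / (a + 1) < (1 - lo) / a"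
      using a lo by (intro divide_strict_left_mono) auto
    also have "\<dots> = c - lo"
      using lo(3) a by (simp add: field_simps)
    finally show ?thesis
      by (simp add: z_def)
  qed
  moreover have "1 - a * (z - lo) = z"
    using a by (simp add: z_def field_simps)
  ultimately have "adm lo c a b (2 # replicate k 1) 1" for k
    using adm_replicate_fixed_point z lo by simp
  then have "starts_with (expansion \<beta> 1) ((phi_fin ^^ m) (2 # replicate k 1))" for k
    using adm adm_starts_with_expansion[OF \<beta> less_two_of_power_le[OF _ \<beta> le]] by simp
  moreover have "starts_with ((phi_inf ^^ m) (2 ## sconst 1)) ((phi_fin ^^ m) (2 # replicate k 1))" for k
  proof -
    have "sconst 1 = replicate k 1 @- sconst (1 :: int)"
    proof (induction k)
      case (Suc k)
      have "sconst 1 = 1 ## sconst (1 :: int)"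
        by (subst siterate.code) simp
      with Suc show ?case
        by (metis replicate_Suc shift.simps(2))
    qed simp
    then have "2 ## sconst 1 = (2 # replicate k 1) @- sconst (1 :: int)"
      by simp
    then show ?thesis
      unfolding starts_with_iff by (metis phi_inf_funpow_shift)
  qed
  \<comment> \<open>The common prefixes become arbitrarily long, so they determine the whole
    stream.\<close>
  moreover have "k \<le> length ((phi_fin ^^ m) (2 # replicate k 1))" for k
    using length_phi_fin_funpow_ge[of "2 # replicate k 1" m] by simp
  ultimately show ?thesis
    unfolding \<beta>_def by (rule stream_eqI_starts_with)
qed

section \<open>Convergence to the fixed point\<close>

lemma word_tendsto_expansion: "word_tendsto (\<lambda>\<beta>. expansion \<beta> 1) phi_limit (at_right 1)"
  unfolding word_tendsto_def
proof
  fix l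
  \<comment> \<open>The successor ensures \<open>n \<ge> 1\<close>, so that \<open>gam n > 1\<close>
    and \<open>(1, gam n)\<close> is a right neighbourhood of 1 on which the first \<open>l\<close>
    letters agree.\<close>
  define n where "n = Suc l"
  have n: "n \<ge> 1" "l \<le> length ((phi_fin ^^ n) [2])"
    using length_phi_fin_funpow_two[of n] by (simp_all add: n_def)
  show "\<forall>\<^sub>F \<beta> in at_right 1. stake l (expansion \<beta> 1) = stake l phi_limit"
    using eventually_at_right_less eventually_at_right_real[OF gam_properties(1)[OF n(1)]]
  proof eventually_elim
    case (elim \<beta>)
    then show ?case
      using expansion_starts_with_phi[OF n(1), of \<beta>] starts_with_phi_limit n(2)
      by (intro starts_with_agree) auto
  qed
qed

lemma word_tendsto_phi_inf_funpow:
  "word_tendsto (\<lambda>n. (phi_inf ^^ n) (2 ## s)) phi_limit sequentially"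
  unfolding word_tendsto_def
proof
  fix l
  show "\<forall>\<^sub>F n in sequentially. stake l ((phi_inf ^^ n) (2 ## s)) = stake l phi_limit"
    using eventually_ge_at_top[of l]
  proof eventually_elim
    case (elim n)
    have "starts_with ((phi_inf ^^ n) (2 ## s)) ((phi_fin ^^ n) [2])"
      using phi_inf_funpow_shift[of n "[2]" s] by (auto simp: starts_with_iff)
    then show ?case
      using elim length_phi_fin_funpow_two[of n] starts_with_phi_limit
      by (intro starts_with_agree) auto
  qed
qed

theorem theorem2p5:
  shows "(\<forall>n\<ge>1. expansion (gam n) 1 = (phi_inf ^^ (n - 1)) (2 ## sconst 1)) \<and>
    (\<forall>n\<ge>1. \<forall>\<beta>. 1 < \<beta> \<and> \<beta> \<le> gam n \<longrightarrow>
        starts_with (expansion \<beta> 1) ((phi_fin ^^ n) [2])) \<and>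
    (\<exists>u. u \<in> streams {1, 2} \<and> phi_inf u = u \<and>
        (\<forall>v \<in> streams {1, 2}. phi_inf v = v \<longrightarrow> v = u) \<and>
        word_tendsto (\<lambda>\<beta>. expansion \<beta> 1) u (at_right 1) \<and>
        word_tendsto (\<lambda>n. (phi_inf ^^ n) (2 ## sconst 1)) u sequentially \<and>
        starts_with u [2,1,1,2,2,2,1,1,2,1,1,2,1,1,2,2,2,1,1,2,2])"
proof (intro conjI exI[of _ phi_limit])
  show "\<forall>n\<ge>1. expansion (gam n) 1 = (phi_inf ^^ (n - 1)) (2 ## sconst 1)"
  proof (intro allI impI)
    fix n :: nat
    assume "n \<ge> 1"
    then show "expansion (gam n) 1 = (phi_inf ^^ (n - 1)) (2 ## sconst 1)"
      using expansion_gam[of "n - 1"] by simp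
  qed
  show "starts_with phi_limit [2,1,1,2,2,2,1,1,2,1,1,2,1,1,2,2,2,1,1,2,2]"
    \<comment> \<open>The displayed 21 letters are exactly the fourth iterate on \<open>[2]\<close>;
      the iterates have lengths 1, 3, 5, 11, 21.\<close>
    using starts_with_phi_limit[of 4] by (simp add: eval_nat_numeral)
qed (use expansion_starts_with_phi phi_limit_in_streams phi_inf_phi_limit
    phi_inf_fixed_point_unique word_tendsto_expansion word_tendsto_phi_inf_funpow in auto)

end
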